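(* Let $n,k\ge 2$ be integers. (1) If $\mathrm{rad}(n)\nmid \mathrm{rad}(k)$, then $\mathsf{D}^*(n,nk)=\eta^*(n,nk)=\infty$. (2) If $\mathrm{rad}(n)\mid \mathrm{rad}(k)$, then $\mathsf{D}^*(n,nk)=\eta^*(n,nk)=2n-1$.
   Context: For a positive integer $n$, $\mathrm{rad}(n)=\prod_{p\mid n}p$ is the product of the distinct prime divisors of $n$, with $\mathrm{rad}(1)=1$. For integers $n,k\ge 2$: - $\mathsf{D}^*(n,nk)$ is the smallest positive integer $\ell$ such that, from any given $\ell$ integers (repetitions allowed) none of which is divisible by $n$, one can select some of them (a non-empty sub-multiset) whose sum is divisible by $n$ but not by $nk$; if no such $\ell$ exists, $\mathsf{D}^*(n,nk)=\infty$. - $\eta^*(n,nk)$ is the smallest positive integer $\ell$ such that, from any given $\ell$ integers (repetitions allowed) none of which is divisible by $n$, one can select at most $n$ of them (and at least one) whose sum is divisible by $n$ but not by $nk$; if no such $\ell$ exists, $\eta^*(n,nk)=\infty$. *)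

theory Defs
  imports "HOL-Computational_Algebra.Computational_Algebra"
    "HOL-Library.Multiset" "HOL-Library.Extended_Nat"
begin

definition rad :: "nat \<Rightarrow> nat" where
  "rad n = (\<Prod>p\<in>prime_factors n. p)"

(* In the next two definitions the infimum in enat of a nonempty set is its least element,
   and the infimum of the empty set is \<infinity>. The second argument m stands for n * k. *)

definition D_star :: "nat \<Rightarrow> nat \<Rightarrow> enat" where
  "D_star n m = Inf {enat l | l. l > 0 \<and>
     (\<forall>S :: int multiset. size S = l \<and> (\<forall>x\<in>#S. \<not> int n dvd x) \<longrightarrow>
        (\<exists>T. T \<subseteq># S \<and> T \<noteq> {#} \<and>
             int n dvd sum_mset T \<and> \<not> int m dvd sum_mset T))}"

definition eta_star :: "nat \<Rightarrow> nat \<Rightarrow> enat" where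
  "eta_star n m = Inf {enat l | l. l > 0 \<and>
     (\<forall>S :: int multiset. size S = l \<and> (\<forall>x\<in>#S. \<not> int n dvd x) \<longrightarrow>
        (\<exists>T. T \<subseteq># S \<and> T \<noteq> {#} \<and> size T \<le> n \<and>
             int n dvd sum_mset T \<and> \<not> int m dvd sum_mset T))}"

end

(* Upper bound. By a greedy choice, every multiset of integers has a submultiset A with fewer than n
   elements whose subset sums modulo n are stable under translation by all remaining elements;
   as 0 is a subset sum, they contain all combinations of the remaining elements. Suppose that
   2n - 1 integers have only multiples of nk among their subset sums divisible by n. Choose A, then
   choose B in the same way among the remaining R, and a last element b outside A and B. Every subset
   sum of R is completed by A to a multiple of n, hence of nk, so subset sums of R that agree
   modulo n agree modulo nk. Thus the subset sums of B contain all multiples of b modulo nk, and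
   d b = 0 modulo nk for the order d of b modulo n, which is impossible if every prime divisor of n
   divides k. The length restriction comes for free: a zero-sum multiset modulo n with more than n
   elements splits into two smaller ones, one of which keeps a sum not divisible by nk.

   Lower bounds: n - 1 copies of each of 1 and -1, and, for a prime p dividing n but not k,
   arbitrarily many copies of kn/p. *)

theory Submission
  imports Defs "HOL-Number_Theory.Cong"
begin

section \<open>Subset sums modulo \<open>n\<close> and short zero-sum submultisets\<close>

text \<open>Take \<open>A\<close> as large as possible among the submultisets with more subset sums
  modulo \<open>n\<close> than elements. If translation by a remaining \<open>b\<close> led out of
  these sums, adding \<open>b\<close> to \<open>A\<close> would gain a residue and keep that
  property.\<close>

lemma translation_stable_subset_sums:
  fixes S :: "int multiset" and n :: nat
  assumes "n > 0"
  obtains A where "A \<subseteq># S" "size A < n"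
    "\<And>b T. b \<in># S - A \<Longrightarrow> T \<subseteq># A \<Longrightarrow> \<exists>T'. T' \<subseteq># A \<and> [sum_mset T' = sum_mset T + b] (mod int n)"
proof -
  define X where "X A = (\<lambda>T. sum_mset T mod int n) ` {T. T \<subseteq># A}" for A
  have sub: "X A \<subseteq> {0..<int n}" for A
    using assms by (auto simp: X_def)
  have fin: "finite (X A)" for A
    using sub finite_subset by blast
  have card_le: "card (X A) \<le> n" for A
    using card_mono[OF _ sub, of A] by simp
  \<comment> \<open>The strict inequality holds for \<open>{#}\<close>, whose only sum is 0, and
    forces \<open>size A < n\<close>, since there are at most \<open>n\<close> residues.\<close>
  define P where "P A \<longleftrightarrow> A \<subseteq># S \<and> size A < card (X A)" for A
  have "{T :: int multiset. T \<subseteq># {#}} = {{#}}"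
    by auto
  hence "P {#}"
    by (simp add: P_def X_def)
  moreover have "\<forall>A. P A \<longrightarrow> size A < n"
    using card_le by (metis P_def less_le_trans)
  ultimately obtain A where A: "P A" and max: "\<And>A'. P A' \<Longrightarrow> size A' \<le> size A"
    using ex_has_greatest_nat[of P "{#}" size n] by blast
  show thesis
  proof (rule that)
    show "A \<subseteq># S" "size A < n"
      using A card_le[of A] by (auto simp: P_def)
    fix b T assume b: "b \<in># S - A" and T: "T \<subseteq># A"
    show "\<exists>T'. T' \<subseteq># A \<and> [sum_mset T' = sum_mset T + b] (mod int n)"
    proof (rule ccontr)
      assume no: "\<nexists>T'. T' \<subseteq># A \<and> [sum_mset T' = sum_mset T + b] (mod int n)"
      let ?A = "add_mset b A" and ?r = "(sum_mset T + b) mod int n"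
      have "?A \<subseteq># S"
        using subset_mset.add_mono[of "{#b#}" "S - A" A A] b \<open>A \<subseteq># S\<close> by simp
      moreover have "X A \<subseteq> X ?A"
        unfolding X_def by (intro image_mono) (auto intro: subset_mset.order_trans)
      moreover have "?r \<in> X ?A"
        using T by (auto simp: X_def image_iff intro!: exI[of _ "add_mset b T"] simp: add.commute)
      moreover have "?r \<notin> X A"
        using no by (auto simp: X_def cong_def)
      ultimately have "?A \<subseteq># S" "card (X A) < card (X ?A)"
        using fin[of ?A] by (auto intro!: psubset_card_mono)
      hence "P ?A"
        using A by (simp add: P_def)
      from max[OF this] show False
        by simp
    qed
  qed
qed

text \<open>Translation steps are iterated from the empty sum. Only the support of \<open>M\<close>
  must lie in \<open>S - A\<close>, so elements may be repeated at will.\<close>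

lemma subset_sums_absorb:
  fixes S :: "int multiset" and n :: nat
  assumes "n > 0"
  obtains A where "A \<subseteq># S" "size A < n"
    "\<And>M. set_mset M \<subseteq> set_mset (S - A) \<Longrightarrow> \<exists>T. T \<subseteq># A \<and> [sum_mset T = sum_mset M] (mod int n)"
proof -
  obtain A where A: "A \<subseteq># S" "size A < n"
    and step: "\<And>b T. b \<in># S - A \<Longrightarrow> T \<subseteq># A \<Longrightarrow> \<exists>T'. T' \<subseteq># A \<and> [sum_mset T' = sum_mset T + b] (mod int n)"
    using translation_stable_subset_sums[OF assms] by metis
  have "\<exists>T. T \<subseteq># A \<and> [sum_mset T = sum_mset M] (mod int n)"
    if "set_mset M \<subseteq> set_mset (S - A)" for M
    using that
  proof (induction M)
    case empty
    show ?case by (rule exI[of _ "{#}"]) simp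
  next
    case (add b M)
    then obtain T where T: "T \<subseteq># A" "[sum_mset T = sum_mset M] (mod int n)"
      by auto
    obtain T' where T': "T' \<subseteq># A" "[sum_mset T' = sum_mset T + b] (mod int n)"
      using step[of b T] add.prems T by auto
    have "[sum_mset T + b = sum_mset M + b] (mod int n)"
      using T(2) by (simp add: cong_add)
    with T' show ?case
      by (auto simp: add.commute intro: cong_trans)
  qed
  with A show thesis
    using that by blast
qed

text \<open>Since \<open>n - 1\<close> copies of \<open>M\<close> have sum congruent to minus that
  of \<open>M\<close>, negatives are absorbed as well.\<close>

lemma subset_sums_absorb_neg:
  fixes S :: "int multiset" and n :: nat
  assumes "n > 0"
    and "\<And>M. set_mset M \<subseteq> set_mset R \<Longrightarrow> \<exists>T. T \<subseteq># A \<and> [sum_mset T = sum_mset M] (mod int n)"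
    and "set_mset M \<subseteq> set_mset R"
  shows "\<exists>T. T \<subseteq># A \<and> int n dvd sum_mset T + sum_mset M"
proof -
  have "set_mset (repeat_mset (n - 1) M) \<subseteq> set_mset M"
    by (auto simp flip: count_greater_zero_iff)
  hence "set_mset (repeat_mset (n - 1) M) \<subseteq> set_mset R"
    using assms(3) by blast
  then obtain T where T: "T \<subseteq># A"
    "[sum_mset T = sum_mset (repeat_mset (n - 1) M)] (mod int n)"
    using assms(2) by blast
  have "sum_mset (repeat_mset c M) = int c * sum_mset M" for c
    by (induction c) (simp_all add: algebra_simps)
  hence "sum_mset (repeat_mset (n - 1) M) + sum_mset M = int n * sum_mset M"
    using assms(1) by (simp add: of_nat_diff algebra_simps)
  with T have "[sum_mset T + sum_mset M = int n * sum_mset M] (mod int n)"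
    by (metis cong_add cong_refl)
  hence "int n dvd sum_mset T + sum_mset M"
    by (simp add: cong_dvd_iff)
  with T show ?thesis by blast
qed

text \<open>Some \<open>b\<close> lies outside \<open>A\<close>, and a submultiset of
  \<open>A\<close> absorbs \<open>-b\<close>; together with \<open>b\<close> it has at most
  \<open>n\<close> elements.\<close>

lemma zero_sum_submultiset:
  fixes S :: "int multiset" and n :: nat
  assumes "n > 0" "size S \<ge> n"
  obtains U where "U \<subseteq># S" "U \<noteq> {#}" "size U \<le> n" "int n dvd sum_mset U"
proof -
  obtain A where A: "A \<subseteq># S" "size A < n"
    and absorb: "\<And>M. set_mset M \<subseteq> set_mset (S - A) \<Longrightarrow> \<exists>T. T \<subseteq># A \<and> [sum_mset T = sum_mset M] (mod int n)"
    using subset_sums_absorb[OF assms(1)] by metis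
  have "size (S - A) \<noteq> 0"
    using A assms by (simp add: size_Diff_submset)
  then obtain b where b: "b \<in># S - A"
    by (metis size_empty multiset_nonemptyE)
  hence "set_mset {#b#} \<subseteq> set_mset (S - A)"
    by simp
  then obtain T where T: "T \<subseteq># A" "int n dvd sum_mset T + sum_mset {#b#}"
    using subset_sums_absorb_neg[OF assms(1) absorb] by blast
  have "T + {#b#} \<subseteq># A + (S - A)"
    using T b by (intro subset_mset.add_mono) auto
  hence "T + {#b#} \<subseteq># S"
    using A by simp
  moreover have "size (T + {#b#}) \<le> n"
    using size_mset_mono[OF T(1)] A by simp
  ultimately show thesis
    using T that[of "T + {#b#}"] by (simp add: add.commute)
qed

text \<open>Split off a short zero-sum \<open>U\<close>. Either its sum is not divisible by
  \<open>m\<close>, or the smaller \<open>S - U\<close> inherits both hypotheses.\<close>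

lemma short_zero_sum_submultiset:
  fixes S :: "int multiset" and n m :: nat
  assumes "n > 0" "int n dvd sum_mset S" "\<not> int m dvd sum_mset S"
  shows "\<exists>T. T \<subseteq># S \<and> size T \<le> n \<and> int n dvd sum_mset T \<and> \<not> int m dvd sum_mset T"
  using assms(2,3)
proof (induction "size S" arbitrary: S rule: less_induct)
  case less
  show ?case
  proof (cases "size S \<le> n")
    case False
    then obtain U where U: "U \<subseteq># S" "U \<noteq> {#}" "size U \<le> n" "int n dvd sum_mset U"
      using zero_sum_submultiset[OF assms(1), of S] by auto
    have S: "sum_mset S = sum_mset U + sum_mset (S - U)"
      using U(1) by (metis sum_mset.union subset_mset.add_diff_inverse)
    show ?thesis
    proof (cases "int m dvd sum_mset U")
      case True
      have "size (S - U) < size S"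
        using U False by (simp add: size_Diff_submset nonempty_has_size)
      moreover have "int n dvd sum_mset (S - U)" "\<not> int m dvd sum_mset (S - U)"
        using S U True less.prems by (auto simp: dvd_add_right_iff)
      ultimately show ?thesis
        using less.hyps[of "S - U"] diff_subset_eq_self subset_mset.order_trans by blast
    qed (use U in blast)
  qed (use less.prems in blast)
qed

section \<open>The upper bound\<close>

lemma zero_sum_not_dvd:
  fixes S :: "int multiset" and n k :: nat
  assumes "n > 0" and rad: "\<And>p. prime p \<Longrightarrow> p dvd n \<Longrightarrow> p dvd k"
    and size: "size S = 2 * n - 1" and nd: "\<forall>x\<in>#S. \<not> int n dvd x"
  shows "\<exists>T. T \<subseteq># S \<and> int n dvd sum_mset T \<and> \<not> int (n * k) dvd sum_mset T"
proof (rule ccontr)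
  assume "\<not> ?thesis"
  hence all: "int (n * k) dvd sum_mset T" if "T \<subseteq># S" "int n dvd sum_mset T" for T
    using that by blast
  obtain A where A: "A \<subseteq># S" "size A < n"
    and absA: "\<And>M. set_mset M \<subseteq> set_mset (S - A) \<Longrightarrow> \<exists>T. T \<subseteq># A \<and> [sum_mset T = sum_mset M] (mod int n)"
    using subset_sums_absorb[OF assms(1)] by metis
  define R where "R = S - A"
  obtain B where B: "B \<subseteq># R" "size B < n"
    and absB: "\<And>M. set_mset M \<subseteq> set_mset (R - B) \<Longrightarrow> \<exists>T. T \<subseteq># B \<and> [sum_mset T = sum_mset M] (mod int n)"
    using subset_sums_absorb[OF assms(1)] by metis
  \<comment> \<open>This is where \<open>2 * n - 1\<close> comes from: \<open>A\<close> and
    \<open>B\<close> take at most \<open>n - 1\<close> elements each.\<close>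
  have "size (R - B) \<noteq> 0"
    using A B size size_Diff_submset[OF A(1)] size_Diff_submset[OF B(1)] by (simp add: R_def)
  then obtain b where b: "b \<in># R - B"
    by (metis size_empty multiset_nonemptyE)
  \<comment> \<open>The same \<open>T\<close> from \<open>A\<close> completes both \<open>V\<close>
    and \<open>W\<close> to multiples of \<open>n\<close>, hence of \<open>n * k\<close>; in the
    difference \<open>T\<close> cancels.\<close>
  have lift: "[sum_mset V = sum_mset W] (mod int (n * k))"
    if V: "V \<subseteq># R" and W: "W \<subseteq># R" and VW: "[sum_mset V = sum_mset W] (mod int n)" for V W
  proof -
    obtain T where T: "T \<subseteq># A" "int n dvd sum_mset T + sum_mset V"
      using subset_sums_absorb_neg[OF assms(1) absA] V set_mset_mono unfolding R_def by metis
    have "[sum_mset T + sum_mset V = sum_mset T + sum_mset W] (mod int n)"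
      using VW by (simp add: cong_add)
    hence TW: "int n dvd sum_mset T + sum_mset W"
      using T by (simp add: cong_dvd_iff)
    have "T + Y \<subseteq># S" if "Y \<subseteq># R" for Y
      using subset_mset.add_mono[OF T(1) that] A by (simp add: R_def)
    hence "int (n * k) dvd sum_mset T + sum_mset V" "int (n * k) dvd sum_mset T + sum_mset W"
      using all[of "T + V"] all[of "T + W"] V W T TW by auto
    hence "int (n * k) dvd (sum_mset T + sum_mset V) - (sum_mset T + sum_mset W)"
      by (rule dvd_diff)
    thus ?thesis
      by (simp add: cong_iff_dvd_diff)
  qed
  \<comment> \<open>Induction on \<open>j\<close>: adding \<open>b\<close> to a submultiset of
    \<open>B\<close> gives a submultiset of \<open>R\<close>. \<open>B\<close> reproduces its sum
    modulo \<open>n\<close>, and \<open>lift\<close> raises this to a congruence modulo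
    \<open>n * k\<close>.\<close>
  have mult: "\<exists>T. T \<subseteq># B \<and> [sum_mset T = int j * b] (mod int (n * k))" for j :: nat
  proof (induction j)
    case 0
    show ?case by (rule exI[of _ "{#}"]) simp
  next
    case (Suc j)
    then obtain T where T: "T \<subseteq># B" "[sum_mset T = int j * b] (mod int (n * k))"
      by blast
    have Tb: "[sum_mset (T + {#b#}) = int (Suc j) * b] (mod int (n * k))"
      using cong_add[OF T(2) cong_refl[of b]] by (simp add: algebra_simps)
    have "set_mset (replicate_mset (Suc j) b) \<subseteq> set_mset (R - B)"
      using b by (simp only: set_mset_replicate_mset_subset) simp
    from absB[OF this] obtain T' where
      T': "T' \<subseteq># B" "[sum_mset T' = int (Suc j) * b] (mod int n)"
      unfolding sum_mset_replicate_mset by blast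
    have "[sum_mset (T + {#b#}) = int (Suc j) * b] (mod int n)"
      using Tb by (rule cong_dvd_modulus) simp
    hence "[sum_mset T' = sum_mset (T + {#b#})] (mod int n)"
      using T'(2) by (metis cong_sym cong_trans)
    moreover have "T + {#b#} \<subseteq># R"
      using subset_mset.add_mono[OF T(1), of "{#b#}" "R - B"] b B by simp
    ultimately have "[sum_mset T' = sum_mset (T + {#b#})] (mod int (n * k))"
      using lift[of T' "T + {#b#}"] T'(1) B(1) subset_mset.order_trans by blast
    with Tb T'(1) show ?case
      using cong_trans by blast
  qed
  \<comment> \<open>The quotient \<open>d\<close> of \<open>n\<close> by this gcd is the order of
    \<open>b\<close> modulo \<open>n\<close>, and \<open>d * b = n * c\<close> with \<open>c\<close>
    coprime to \<open>d\<close>.\<close>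
  define g where "g = gcd (int n) b"
  have g: "g > 0"
    using assms(1) by (simp add: g_def)
  obtain d' c where d': "int n = g * d'" and c: "b = g * c" and cop: "coprime d' c"
    using gcd_coprime_exists[of "int n" b] g unfolding g_def by (metis less_irrefl mult.commute)
  have "0 < g * d'"
    using d' assms(1) by simp
  hence "d' > 0"
    using g by (simp add: zero_less_mult_iff)
  then obtain d where "d' = int d"
    using zero_less_imp_eq_int by blast
  with d' cop have d: "int n = g * int d" and cop: "coprime (int d) c"
    by simp_all
  have db: "int d * b = int n * c"
    using d c by simp
  obtain T where T: "T \<subseteq># B" "[sum_mset T = int n * c] (mod int (n * k))"
    using mult[of d] db by auto
  have "[sum_mset T = int n * c] (mod int n)"
    using T(2) by (rule cong_dvd_modulus) simp
  hence "int n dvd sum_mset T"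
    by (simp add: cong_dvd_iff)
  moreover have "T \<subseteq># S"
    using T(1) B(1) diff_subset_eq_self[of S A] unfolding R_def by (meson subset_mset.order_trans)
  ultimately have "int (n * k) dvd int n * c"
    using all cong_dvd_iff[OF T(2)] by blast
  hence kc: "int k dvd c"
    using assms(1) by simp
  have "b \<in># S"
    using b by (auto simp: R_def dest!: in_diffD)
  hence "\<not> int n dvd b"
    using nd by blast
  \<comment> \<open>A prime divisor of \<open>d\<close> divides \<open>n\<close>, hence
    \<open>k\<close>, hence \<open>c\<close>, against coprimality.\<close>
  hence "d \<noteq> 1"
    unfolding c d by (metis dvd_triv_left mult.right_neutral of_nat_1)
  then obtain p where p: "prime p" "p dvd d"
    using prime_factor_nat by blast
  have "int p dvd int n"
    unfolding d using p(2) by simp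
  hence "int p dvd c"
    using rad[OF p(1)] kc by (meson dvd_trans of_nat_dvd_iff)
  moreover have "int p dvd int d"
    using p(2) by simp
  ultimately have "is_unit (int p)"
    using cop by (metis coprime_common_divisor)
  thus False
    using p(1) by simp
qed

section \<open>Radicals, extremal multisets and the infimum in \<open>enat\<close>\<close>

lemma rad_dvd_rad_iff:
  assumes "n > 0" "k > 0"
  shows "rad n dvd rad k \<longleftrightarrow> (\<forall>p. prime p \<longrightarrow> p dvd n \<longrightarrow> p dvd k)"
proof
  assume *: "rad n dvd rad k"
  show "\<forall>p. prime p \<longrightarrow> p dvd n \<longrightarrow> p dvd k"
  proof (intro allI impI)
    fix p assume p: "prime p" "p dvd n"
    hence "p dvd rad n"
      using assms unfolding rad_def by (intro dvd_prodI) (auto simp: in_prime_factors_iff)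
    hence "p dvd (\<Prod>q\<in>prime_factors k. q)"
      using * unfolding rad_def by (rule dvd_trans)
    then obtain q where "q \<in> prime_factors k" "p dvd q"
      using p(1) by (auto simp: prime_dvd_prod_iff)
    thus "p dvd k"
      by (meson dvd_trans in_prime_factors_iff)
  qed
next
  assume "\<forall>p. prime p \<longrightarrow> p dvd n \<longrightarrow> p dvd k"
  hence "prime_factors n \<subseteq> prime_factors k"
    using assms by (auto simp: in_prime_factors_iff)
  thus "rad n dvd rad k"
    unfolding rad_def by (intro prod_dvd_prod_subset) auto
qed

text \<open>The sum lies strictly between \<open>-n\<close> and \<open>n\<close>, where 0 is the
  only multiple of \<open>n\<close>.\<close>

lemma plus_minus_one_zero_sum:
  fixes T :: "int multiset" and n a b :: nat
  assumes "T \<subseteq># replicate_mset a 1 + replicate_mset b (- 1)" "a < n" "b < n"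
    and "int n dvd sum_mset T"
  shows "sum_mset T = 0"
proof -
  have "set_mset T \<subseteq> {1, - 1}"
    using set_mset_mono[OF assms(1)] by (auto split: if_splits)
  hence "T = replicate_mset (count T 1) 1 + replicate_mset (count T (- 1)) (- 1)"
    by (intro multiset_eqI) (auto simp: not_in_iff[symmetric])
  hence sum: "sum_mset T = int (count T 1) - int (count T (- 1))"
    by (metis sum_mset.union sum_mset_replicate_mset mult.right_neutral mult_minus_right
        diff_conv_add_uminus)
  have "count T 1 \<le> a" "count T (- 1) \<le> b"
    using mset_subset_eq_count[OF assms(1), of 1] mset_subset_eq_count[OF assms(1), of "- 1"]
    by simp_all
  hence "\<bar>sum_mset T\<bar> < int n"
    using sum assms(2,3) by linarith
  thus ?thesis
    using assms(4) dvd_imp_le_int[of "sum_mset T" "int n"] by fastforce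
qed

text \<open>Shaped to match both \<open>D_star\<close> and \<open>eta_star\<close>. Monotonicity in
  the length is not assumed, so each smaller \<open>l'\<close> has its own counterexample.\<close>

lemma Inf_enat_eqI:
  assumes "l > 0" "\<And>S. P l S \<Longrightarrow> R S" "\<And>l'. l' < l \<Longrightarrow> \<exists>S. P l' S \<and> \<not> R S"
  shows "Inf {enat l | l. l > 0 \<and> (\<forall>S. P l S \<longrightarrow> R S)} = enat l"
proof (rule antisym)
  show "Inf {enat l | l. l > 0 \<and> (\<forall>S. P l S \<longrightarrow> R S)} \<le> enat l"
    using assms(1,2) by (intro Inf_lower) auto
  have "l \<le> l'" if "\<forall>S. P l' S \<longrightarrow> R S" for l'
    using assms(3)[of l'] that by (meson not_less)
  thus "enat l \<le> Inf {enat l | l. l > 0 \<and> (\<forall>S. P l S \<longrightarrow> R S)}"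
    by (intro Inf_greatest) auto
qed

text \<open>With \<open>n = p * m\<close>, the sum \<open>t * k * m\<close> of \<open>t\<close>
  copies of \<open>x\<close> is divisible by \<open>n\<close> only if \<open>p\<close> divides
  \<open>t\<close>, and is then a multiple of \<open>p * k * m = n * k\<close>.\<close>

lemma prime_witness_zero_sum:
  fixes n k p :: nat and T :: "int multiset"
  assumes "prime p" "p dvd n" "\<not> p dvd k" "n > 0"
  defines "x \<equiv> int (k * (n div p))"
  shows "\<not> int n dvd x"
    and "T \<subseteq># replicate_mset l x \<Longrightarrow> int n dvd sum_mset T \<Longrightarrow> int (n * k) dvd sum_mset T"
proof -
  obtain m where n: "n = p * m"
    using assms(2) by (elim dvdE)
  hence m: "m > 0" "n div p = m"
    using assms by (auto simp: prime_gt_0_nat)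
  have x: "x = int (k * m)"
    by (simp only: x_def m(2))
  have dvd: "int n dvd int t * x \<longleftrightarrow> p dvd t" for t
  proof -
    have "int n dvd int t * x \<longleftrightarrow> p * m dvd (t * k) * m"
      by (simp only: x n of_nat_mult[symmetric] of_nat_dvd_iff mult.assoc)
    also have "\<dots> \<longleftrightarrow> p dvd t"
      using m assms(1,3) by (simp add: prime_dvd_mult_iff)
    finally show ?thesis .
  qed
  show "\<not> int n dvd x"
    using dvd[of 1] assms(1) by auto
  assume "T \<subseteq># replicate_mset l x" "int n dvd sum_mset T"
  moreover from this have sum: "sum_mset T = int (size T) * x"
    by (metis msubseteq_replicate_msetE size_replicate_mset sum_mset_replicate_mset)
  ultimately obtain s where s: "size T = p * s"
    using dvd by auto
  have "sum_mset T = int (n * k) * int s"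
    by (simp add: sum s x n)
  thus "int (n * k) dvd sum_mset T"
    by simp
qed

section \<open>Evaluation of both constants\<close>

theorem theorem1p2:
  fixes n k :: nat
  assumes "n \<ge> 2" and "k \<ge> 2"
  shows "(\<not> rad n dvd rad k \<longrightarrow>
            D_star n (n * k) = \<infinity> \<and> eta_star n (n * k) = \<infinity>) \<and>
         (rad n dvd rad k \<longrightarrow>
            D_star n (n * k) = enat (2 * n - 1) \<and> eta_star n (n * k) = enat (2 * n - 1))"
proof (intro conjI impI)
  assume "\<not> rad n dvd rad k"
  then obtain p where p: "prime p" "p dvd n" "\<not> p dvd k"
    using assms rad_dvd_rad_iff[of n k] by auto
  define x where "x = int (k * (n div p))"
  \<comment> \<open>No bound on \<open>size T\<close> appears here, so the same multisets rule out
    every length in both definitions.\<close>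
  have bad: "size (replicate_mset l x) = l \<and> (\<forall>y\<in>#replicate_mset l x. \<not> int n dvd y) \<and>
      \<not> (\<exists>T. T \<subseteq># replicate_mset l x \<and> int n dvd sum_mset T \<and> \<not> int (n * k) dvd sum_mset T)" for l
    using prime_witness_zero_sum[OF p] assms(1) unfolding x_def by auto
  have "{enat l | l. l > 0 \<and>
     (\<forall>S :: int multiset. size S = l \<and> (\<forall>x\<in>#S. \<not> int n dvd x) \<longrightarrow>
        (\<exists>T. T \<subseteq># S \<and> T \<noteq> {#} \<and> int n dvd sum_mset T \<and> \<not> int (n * k) dvd sum_mset T))} = {}"
    using bad by blast
  thus "D_star n (n * k) = \<infinity>"
    unfolding D_star_def by (simp only: Inf_empty) (simp add: top_enat_def)
  have "{enat l | l. l > 0 \<and>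
     (\<forall>S :: int multiset. size S = l \<and> (\<forall>x\<in>#S. \<not> int n dvd x) \<longrightarrow>
        (\<exists>T. T \<subseteq># S \<and> T \<noteq> {#} \<and> size T \<le> n \<and>
          int n dvd sum_mset T \<and> \<not> int (n * k) dvd sum_mset T))} = {}"
    using bad by blast
  thus "eta_star n (n * k) = \<infinity>"
    unfolding eta_star_def by (simp only: Inf_empty) (simp add: top_enat_def)
next
  assume "rad n dvd rad k"
  hence rad: "\<And>p. prime p \<Longrightarrow> p dvd n \<Longrightarrow> p dvd k"
    using assms rad_dvd_rad_iff[of n k] by auto
  have good: "\<exists>T. T \<subseteq># S \<and> T \<noteq> {#} \<and> size T \<le> n \<and>
      int n dvd sum_mset T \<and> \<not> int (n * k) dvd sum_mset T"
    if S: "size S = 2 * n - 1" "\<forall>x\<in>#S. \<not> int n dvd x" for S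
  proof -
    obtain T where T: "T \<subseteq># S" "int n dvd sum_mset T" "\<not> int (n * k) dvd sum_mset T"
      using zero_sum_not_dvd[OF _ rad S] assms by auto
    obtain T' where T': "T' \<subseteq># T" "size T' \<le> n" "int n dvd sum_mset T'"
      "\<not> int (n * k) dvd sum_mset T'"
      using short_zero_sum_submultiset[OF _ T(2,3)] assms by auto
    \<comment> \<open>The empty sum 0 is divisible by \<open>n * k\<close>.\<close>
    have "T' \<noteq> {#}"
      using T'(4) by auto
    with T T' show ?thesis
      using subset_mset.order_trans by blast
  qed
  have bad: "\<exists>S :: int multiset. size S = l \<and> (\<forall>x\<in>#S. \<not> int n dvd x) \<and>
      (\<forall>T. T \<subseteq># S \<longrightarrow> int n dvd sum_mset T \<longrightarrow> int (n * k) dvd sum_mset T)"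
    if "l < 2 * n - 1" for l
  proof -
    \<comment> \<open>At most \<open>n - 1\<close> copies of 1 are used; as \<open>l\<close> is at
      most \<open>2 * n - 2\<close>, at most \<open>n - 1\<close> copies of -1 remain.\<close>
    define a where "a = min l (n - 1)"
    have a: "a < n" "l - a < n" "a \<le> l"
      using that assms(1) by (auto simp: a_def)
    let ?S = "replicate_mset a 1 + replicate_mset (l - a) (- 1) :: int multiset"
    have "size ?S = l"
      using a by simp
    moreover have "\<forall>x\<in>#?S. \<not> int n dvd x"
      using assms(1) by auto
    moreover have "int (n * k) dvd sum_mset T" if "T \<subseteq># ?S" "int n dvd sum_mset T" for T
      using plus_minus_one_zero_sum[OF that(1) a(1,2) that(2)] by simp
    ultimately show ?thesis
      by blast
  qed
  show "D_star n (n * k) = enat (2 * n - 1)"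
    unfolding D_star_def
  proof (rule Inf_enat_eqI, goal_cases)
    case 1
    show ?case using assms(1) by simp
  next
    case (2 S)
    with good[of S] show ?case by blast
  next
    case (3 l)
    then obtain S where S: "size S = l" "\<forall>x\<in>#S. \<not> int n dvd x"
      "\<And>T. T \<subseteq># S \<Longrightarrow> int n dvd sum_mset T \<Longrightarrow> int (n * k) dvd sum_mset T"
      using bad[of l] by blast
    show ?case
      by (rule exI[of _ S]) (use S in blast)
  qed
  show "eta_star n (n * k) = enat (2 * n - 1)"
    unfolding eta_star_def
  proof (rule Inf_enat_eqI, goal_cases)
    case 1
    show ?case using assms(1) by simp
  next
    case (2 S)
    with good[of S] show ?case by blast
  next
    case (3 l)
    then obtain S where S: "size S = l" "\<forall>x\<in>#S. \<not> int n dvd x"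
      "\<And>T. T \<subseteq># S \<Longrightarrow> int n dvd sum_mset T \<Longrightarrow> int (n * k) dvd sum_mset T"
      using bad[of l] by blast
    show ?case
      by (rule exI[of _ S]) (use S in blast)
  qed
qed

end
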